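(* Let $\delta\ge 0$, let $\mathcal{O}$ be an accounting oracle, and consider the algorithm "DPVI for mixture models on vertically partitioned data" (DPVI-VPD) with $P$ parties, sampling probability $q$, $T$ iterations, clipping threshold $C$ and noise parameter $\sigma$, in the variant where the noise is added by the $P$ parties collaboratively, i.e. in each iteration $\boldsymbol{\zeta}=\sum_{p=1}^P\boldsymbol{\zeta}^p$ with independent $\boldsymbol{\zeta}^p\sim\mathcal{N}_{\mathbb{Z}}(0,(C^2\sigma^2/P)\mathbf{I})$. Then DPVI-VPD is $(\epsilon,\delta)$-differentially private with respect to the outside analyst, where $$\epsilon=\mathcal{O}\bigl(\delta,q,T,\mathcal{N}_{\mathbb{Z}/P}(0,\sigma^2)\bigr).$$
   Context: Differential privacy. A dataset is $\mathcal{D}=(x_1,\dots,x_N)$; two datasets are adjacent if they differ in one sample (one sample is replaced). A randomised algorithm $\mathcal{A}$ is $(\epsilon,\delta)$-differentially private (DP) if for all adjacent $\mathcal{D},\mathcal{D}'$ and measurable $S$, $\Pr(\mathcal{A}(\mathcal{D})\in S)\le e^{\epsilon}\Pr(\mathcal{A}(\mathcal{D}')\in S)+\delta$. Discrete Gaussians. $\mathcal{N}_{\mathbb{Z}}(0,s^2)$ is the distribution on $\mathbb{Z}$ with mass at $z$ proportional to $\exp(-z^2/(2s^2))$; $\mathcal{N}_{\mathbb{Z}}(0,s^2\mathbf{I})$ on $\mathbb{Z}^d$ has i.i.d. such coordinates. The distributed discrete Gaussian $\mathcal{N}_{\mathbb{Z}/P}(0,s^2\mathbf{I})$ is the distribution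 of the sum of $P$ independent $\mathcal{N}_{\mathbb{Z}}(0,(s^2/P)\mathbf{I})$ vectors. Base mechanism. As an argument of the oracle, $\mathcal{N}_{\mathbb{Z}/P}(0,\sigma^2)$ denotes the distributed discrete Gaussian mechanism with $P$ parties and noise parameter $\sigma$ relative to the clipping threshold $C$: given a per-example function $f$ (possibly depending on the index) with values in $\{v\in\mathbb{Z}^d:\|v\|_2\le C\}$ and a set $B$ of indices, it outputs $\sum_{i\in B}f(i,x_i)+\boldsymbol{\zeta}$ with $\boldsymbol{\zeta}\sim\mathcal{N}_{\mathbb{Z}/P}(0,C^2\sigma^2\mathbf{I})$. With sub-sampling ratio $q$, $B\subseteq\{1,\dots,N\}$ is random, each index being included independently with probability $q$, and $B$ is not output. A $T$-fold composition runs the mechanism $T$ times with fresh independent noise and sub-samples, releases all outputs, and allows the per-example function of each step to depend on previous outputs and on data-independent randomness. Accounting oracle. An accounting oracle is a function $\mathcal{O}:(\delta,q,T,\mathcal{A})\mapsto\epsilon$ such that every $T$-fold composition of the base mechanism $\mathcal{A}$ with sub-sampling ratio $q$ is $(\epsilon,\delta)$-DP. Algorithm DPVI-VPD. Each sample is split over $P$ parties as $x_n=(x_n^1,\dots,x_n^P)$, party $p$ holding $x_n^p$ for all $n$. The model is a $K$-component mixture with weights $\pi_k$ and component densities $\prod_{p=1}^P\mathcal{F}_p(x_n^p\mid\rho_k^p)$. All vectors entering the multiparty computation (MPC) are in fixed-point representation, i.e. (after scaling) integer vectors obtained by truncation towards zero, with $C$ measured in the same units. In each iteration $t=1,\dots,T$,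 with current parameters $(\pi,\rho)=(\pi^{(t)},\rho^{(t)})$: 1. A random subset $B\subseteq\{1,\dots,N\}$ is drawn, each index being included independently with probability $q$. 2. For each $n\in B$, under MPC, the per-example gradient vector $g_t(x_n)$ is formed; its entries are, for all $k,p$, $$\frac{\prod_{p'}\mathcal{F}_{p'}(x_n^{p'}\mid\rho_k^{p'})}{\sum_{l}\pi_l\prod_{p'}\mathcal{F}_{p'}(x_n^{p'}\mid\rho_l^{p'})}\quad\text{and}\quad \frac{\pi_k\,\frac{\partial \mathcal{F}_p(x_n^p\mid\rho_k^p)}{\partial\rho_k^p}\prod_{p'\ne p}\mathcal{F}_{p'}(x_n^{p'}\mid\rho_k^{p'})}{\sum_{l}\pi_l\prod_{p'}\mathcal{F}_{p'}(x_n^{p'}\mid\rho_l^{p'})}.$$ 3. It is clipped: $g_t^*(x_n)=g_t(x_n)/\max(1,\|g_t(x_n)\|_2/C)$ (in integer representation, so $\|g_t^*(x_n)\|_2\le C$). 4. The vector $\tilde g_t=\sum_{n\in B}g_t^*(x_n)+\boldsymbol{\zeta}$, with fresh noise $\boldsymbol{\zeta}$, is decrypted and released. 5. The data-independent log-prior and entropy gradients are added to $\tilde g_t$, and $(\pi,\rho)$ is updated using the result (and data-independent randomness). The MPC is ideal: it reveals nothing except the released values. The outside analyst observes the released values $\tilde g_1,\dots,\tilde g_T$ (hence also the parameters) and not the subsets $B$ or any noise share. "DP with respect to the outside analyst" means that the randomised map from $\mathcal{D}$ to what the analyst observes is DP. *)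

theory Defs
  imports "HOL-Probability.Probability"
begin

section \<open>Differential privacy\<close>

definition adjacent :: "'s list \<Rightarrow> 's list \<Rightarrow> bool" where
  "adjacent D D' \<longleftrightarrow> (\<exists>i x. i < length D \<and> x \<noteq> D ! i \<and> D' = D[i := x])"

definition differentially_private :: "real \<Rightarrow> real \<Rightarrow> ('s list \<Rightarrow> 'o measure) \<Rightarrow> bool" where
  "differentially_private \<epsilon> \<delta> \<A> \<longleftrightarrow>
     (\<forall>D D' S. adjacent D D' \<longrightarrow> S \<in> sets (\<A> D) \<longrightarrow>
        measure (\<A> D) S \<le> exp \<epsilon> * measure (\<A> D') S + \<delta>)"

text \<open>An accounting oracle has to answer for all arguments, but some mechanisms satisfy no guarantee
  with a finite \<open>\<epsilon>\<close> for the given \<open>\<delta>\<close>, such as the (unbounded) discrete Gaussian for \<open>\<delta> = 0\<close>. With a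
  real-valued oracle, being an accounting oracle would be contradictory. The oracle may therefore
  answer \<open>\<infinity>\<close>, which stands for no guarantee at all; the answer \<open>-\<infinity>\<close> is never correct.\<close>

primrec ext_differentially_private :: "ereal \<Rightarrow> real \<Rightarrow> ('s list \<Rightarrow> 'o measure) \<Rightarrow> bool" where
  "ext_differentially_private (ereal \<epsilon>) \<delta> \<A> \<longleftrightarrow> differentially_private \<epsilon> \<delta> \<A>"
| "ext_differentially_private PInfty \<delta> \<A> \<longleftrightarrow> True"
| "ext_differentially_private MInfty \<delta> \<A> \<longleftrightarrow> False"


section \<open>Discrete Gaussians\<close>

text \<open>The parameter \<open>v\<close> of all the Gaussians is the squared scale \<open>s\<^sup>2\<close>.\<close>

definition gauss_weight :: "real \<Rightarrow> int \<Rightarrow> real" where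
  "gauss_weight v z = exp (- (of_int z)\<^sup>2 / (2 * v))"

definition discrete_gaussian :: "real \<Rightarrow> int pmf" where
  "discrete_gaussian v = embed_pmf (\<lambda>z. gauss_weight v z / (\<Sum>\<^sub>\<infinity>y. gauss_weight v y))"

text \<open>The next two lemmas show that \<^const>\<open>embed_pmf\<close> is applied to a genuine mass function.\<close>

lemma gauss_weight_summable:
  assumes "v > 0"
  shows "gauss_weight v summable_on UNIV"
proof -
  define c where "c = exp (- 1 / (2 * v))"
  have c: "0 < c" "c < 1"
    using assms by (auto simp: c_def)
  have le: "gauss_weight v z \<le> c ^ nat \<bar>z\<bar>" for z
  proof -
    have "\<bar>z\<bar> * 1 \<le> \<bar>z\<bar> * \<bar>z\<bar>"
      by (cases "z = 0") (simp, intro mult_left_mono, linarith+)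
    hence "real_of_int \<bar>z\<bar> \<le> real_of_int (z\<^sup>2)"
      unfolding of_int_le_iff by (simp add: power2_eq_square)
    hence "real (nat \<bar>z\<bar>) \<le> (of_int z)\<^sup>2"
      by simp
    hence "- (of_int z)\<^sup>2 / (2 * v) \<le> real (nat \<bar>z\<bar>) * (- 1 / (2 * v))"
      using assms by (simp add: field_simps)
    thus ?thesis
      unfolding gauss_weight_def c_def exp_of_nat_mult[symmetric] by simp
  qed
  have geo: "(\<lambda>n. c ^ n) summable_on (UNIV :: nat set)"
    using c by (intro norm_summable_imp_summable_on) (auto simp: summable_geometric norm_power)
  have 1: "(\<lambda>z. c ^ nat \<bar>z\<bar>) summable_on range int"
    by (subst summable_on_reindex) (auto simp: o_def geo)
  have 2: "(\<lambda>z. c ^ nat \<bar>z\<bar>) summable_on range (\<lambda>n. - int n)"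
    by (subst summable_on_reindex) (auto simp: o_def geo inj_def)
  have "z \<in> range int \<union> range (\<lambda>n. - int n)" for z
    by (cases z rule: int_cases2) auto
  hence "range int \<union> range (\<lambda>n. - int n) = UNIV"
    by blast
  hence "(\<lambda>z. c ^ nat \<bar>z\<bar>) summable_on UNIV"
    using summable_on_union[OF 1 2] by simp
  thus ?thesis
    by (rule summable_on_comparison_test) (use le in \<open>auto simp: gauss_weight_def\<close>)
qed

lemma pmf_discrete_gaussian:
  assumes "v > 0"
  shows "pmf (discrete_gaussian v) z = gauss_weight v z / (\<Sum>\<^sub>\<infinity>y. gauss_weight v y)"
proof -
  define Z where "Z = (\<Sum>\<^sub>\<infinity>y. gauss_weight v y)"
  have pos: "gauss_weight v y > 0" for y
    by (simp add: gauss_weight_def)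
  have "Z \<ge> (\<Sum>\<^sub>\<infinity>y\<in>{0}. gauss_weight v y)"
    unfolding Z_def by (intro infsum_mono_neutral gauss_weight_summable assms)
      (auto intro: less_imp_le pos)
  hence Z: "Z > 0"
    using pos[of 0] by simp
  have abs: "(\<lambda>y. gauss_weight v y / Z) summable_on UNIV"
    using gauss_weight_summable[OF assms] by (simp add: divide_inverse summable_on_cmult_left)
  have abs': "Infinite_Set_Sum.abs_summable_on (\<lambda>y. gauss_weight v y / Z) UNIV"
    using abs by (metis abs_summable_equivalent summable_on_iff_abs_summable_on_real)
  have "(\<integral>\<^sup>+y. ennreal (gauss_weight v y / Z) \<partial>count_space UNIV)
      = ennreal (infsetsum (\<lambda>y. gauss_weight v y / Z) UNIV)"
    using abs' pos Z
    by (intro nn_integral_conv_infsetsum) (auto simp: less_imp_le)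
  also have "infsetsum (\<lambda>y. gauss_weight v y / Z) UNIV = (\<Sum>\<^sub>\<infinity>y. gauss_weight v y / Z)"
    using abs' by (rule infsetsum_infsum)
  also have "\<dots> = 1"
    unfolding divide_inverse infsum_cmult_left' using Z by (simp add: Z_def)
  finally show ?thesis
    unfolding discrete_gaussian_def Z_def[symmetric]
    using pos Z by (subst pmf_embed_pmf) (auto intro: less_imp_le)
qed

definition discrete_gaussian_vec :: "real \<Rightarrow> (int ^ 'd::finite) pmf" where
  "discrete_gaussian_vec v = map_pmf (\<lambda>z. \<chi> i. z i) (Pi_pmf UNIV 0 (\<lambda>_. discrete_gaussian v))"

definition distributed_discrete_gaussian :: "nat \<Rightarrow> real \<Rightarrow> (int ^ 'd::finite) pmf" where
  "distributed_discrete_gaussian P v =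
     map_pmf (\<lambda>z. \<Sum>p<P. z p) (Pi_pmf {..<P} 0 (\<lambda>_. discrete_gaussian_vec (v / real P)))"


section \<open>Base mechanisms, composition and accounting\<close>

definition real_vec :: "int ^ 'd \<Rightarrow> real ^ 'd" where
  "real_vec v = (\<chi> i. of_int (v $ i))"

text \<open>A base mechanism is given by the set of values allowed for the per-example functions and by
  the law of the noise added to their sum.\<close>

record ('d::finite) base_mechanism =
  example_values :: "(int ^ 'd) set"
  noise :: "(int ^ 'd) pmf"

definition ddg_mechanism :: "real \<Rightarrow> nat \<Rightarrow> real \<Rightarrow> 'd::finite base_mechanism" where
  "ddg_mechanism C P \<sigma> =
     \<lparr> example_values = {v. norm (real_vec v) \<le> C},
       noise = distributed_discrete_gaussian P (C\<^sup>2 * \<sigma>\<^sup>2) \<rparr>"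

definition run_mechanism ::
    "'d::finite base_mechanism \<Rightarrow> (nat \<Rightarrow> 's \<Rightarrow> int ^ 'd) \<Rightarrow> nat set \<Rightarrow> 's list \<Rightarrow> (int ^ 'd) pmf" where
  "run_mechanism A f B D = map_pmf (\<lambda>\<zeta>. (\<Sum>i\<in>B. f i (D ! i)) + \<zeta>) (noise A)"

definition subsample :: "real \<Rightarrow> nat \<Rightarrow> nat set pmf" where
  "subsample q N =
     map_pmf (\<lambda>b. {i \<in> {..<N}. b i}) (Pi_pmf {..<N} False (\<lambda>_. bernoulli_pmf q))"

text \<open>The per-example function of a step is chosen from the list of the previous outputs, whose
  length is the number of the step.\<close>

primrec compose_outputs ::
    "real \<Rightarrow> 'd::finite base_mechanism \<Rightarrow> ((int ^ 'd) list \<Rightarrow> nat \<Rightarrow> 's \<Rightarrow> int ^ 'd) \<Rightarrow>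
     's list \<Rightarrow> nat \<Rightarrow> (int ^ 'd) list pmf" where
  "compose_outputs q A f D 0 = return_pmf []"
| "compose_outputs q A f D (Suc t) =
     do {
       os \<leftarrow> compose_outputs q A f D t;
       B \<leftarrow> subsample q (length D);
       out \<leftarrow> run_mechanism A (f os) B D;
       return_pmf (os @ [out])
     }"

text \<open>The data-independent randomness of all the steps is one sample \<open>\<omega>\<close> of an arbitrary probability
  space \<open>R\<close>; randomness drawn afresh in every step is the case of a product space.\<close>

definition adaptive_choice ::
    "'d::finite base_mechanism \<Rightarrow> 'r measure \<Rightarrow>
     ('r \<Rightarrow> (int ^ 'd) list \<Rightarrow> nat \<Rightarrow> 's \<Rightarrow> int ^ 'd) \<Rightarrow> bool" where
  "adaptive_choice A R f \<longleftrightarrow>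
     (\<forall>\<omega>\<in>space R. \<forall>os i x. f \<omega> os i x \<in> example_values A) \<and>
     (\<forall>os i x. (\<lambda>\<omega>. f \<omega> os i x) \<in> measurable R (count_space UNIV))"

definition composition ::
    "real \<Rightarrow> nat \<Rightarrow> 'd::finite base_mechanism \<Rightarrow> 'r measure \<Rightarrow>
     ('r \<Rightarrow> (int ^ 'd) list \<Rightarrow> nat \<Rightarrow> 's \<Rightarrow> int ^ 'd) \<Rightarrow> 's list \<Rightarrow> (int ^ 'd) list measure" where
  "composition q T A R f D = R \<bind> (\<lambda>\<omega>. measure_pmf (compose_outputs q A (f \<omega>) D T))"

text \<open>HOL cannot quantify over types inside a formula, so the type \<open>'s\<close> of samples and the
  type \<open>'r\<close> of the data-independent randomness are parameters of the notion.\<close>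

definition accounting_oracle ::
    "'s itself \<Rightarrow> 'r itself \<Rightarrow>
     (real \<Rightarrow> real \<Rightarrow> nat \<Rightarrow> 'd::finite base_mechanism \<Rightarrow> ereal) \<Rightarrow> bool" where
  "accounting_oracle S\<^sub>0 R\<^sub>0 \<O> \<longleftrightarrow>
     (\<forall>\<delta> q T A. 0 \<le> \<delta> \<longrightarrow> 0 \<le> q \<longrightarrow> q \<le> 1 \<longrightarrow>
        (\<forall>(R :: 'r measure) (f :: 'r \<Rightarrow> (int ^ 'd) list \<Rightarrow> nat \<Rightarrow> 's \<Rightarrow> int ^ 'd).
           prob_space R \<longrightarrow> adaptive_choice A R f \<longrightarrow>
           ext_differentially_private (\<O> \<delta> q T A) \<delta> (composition q T A R f)))"


section \<open>DPVI for mixture models on vertically partitioned data\<close>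

text \<open>The types \<open>'k\<close>, \<open>'p\<close> and \<open>'j\<close> index the mixture components, the parties, and the coordinates of
  \<open>\<rho>\<^sub>k\<close>. Coordinate \<open>j\<close> belongs to the block of party \<open>owner j\<close>, so that the parties may have
  different numbers of parameters. A sample is the function mapping party \<open>p\<close> to its part.\<close>

type_synonym ('k, 'j) params = "(real ^ 'k) \<times> (real ^ 'j ^ 'k)"
type_synonym ('k, 'j) entry = "'k + 'k \<times> 'j"

text \<open>\<open>party_density p x \<rho>\<close> is \<open>\<F>\<^sub>p(x | \<rho>)\<close>; it is only ever applied to the block of party \<open>p\<close>
  (with zeros elsewhere). \<open>fx_scale\<close> is the factor of the fixed-point representation. The first
  argument of \<open>log_prior_grad\<close>, \<open>entropy_grad\<close> and \<open>update_params\<close> is the iteration, the second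
  one the data-independent randomness.\<close>

record ('k::finite, 'j::finite, 'p::finite, 'x, 'r) dpvi_spec =
  owner :: "'j \<Rightarrow> 'p"
  party_density :: "'p \<Rightarrow> 'x \<Rightarrow> real ^ 'j \<Rightarrow> real"
  fx_scale :: real
  init_params :: "'r \<Rightarrow> ('k, 'j) params"
  log_prior_grad :: "nat \<Rightarrow> 'r \<Rightarrow> ('k, 'j) params \<Rightarrow> real ^ ('k, 'j) entry"
  entropy_grad :: "nat \<Rightarrow> 'r \<Rightarrow> ('k, 'j) params \<Rightarrow> real ^ ('k, 'j) entry"
  update_params ::
    "nat \<Rightarrow> 'r \<Rightarrow> ('k, 'j) params \<Rightarrow> real ^ ('k, 'j) entry \<Rightarrow> ('k, 'j) params"

definition block :: "('j \<Rightarrow> 'p) \<Rightarrow> 'p \<Rightarrow> real ^ 'j \<Rightarrow> real ^ 'j" where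
  "block own p r = (\<chi> j. if own j = p then r $ j else 0)"

definition partial_deriv :: "'j::finite \<Rightarrow> (real ^ 'j \<Rightarrow> real) \<Rightarrow> real ^ 'j \<Rightarrow> real" where
  "partial_deriv j h r = deriv (\<lambda>s. h (r + s *\<^sub>R axis j 1)) 0"

definition local_density ::
    "('k::finite, 'j::finite, 'p::finite, 'x, 'r) dpvi_spec \<Rightarrow> 'p \<Rightarrow> 'x \<Rightarrow> real ^ 'j \<Rightarrow> real" where
  "local_density M p x r = party_density M p x (block (owner M) p r)"

definition mixture_density ::
    "('k::finite, 'j::finite, 'p::finite, 'x, 'r) dpvi_spec \<Rightarrow> ('k, 'j) params \<Rightarrow>
     ('p \<Rightarrow> 'x) \<Rightarrow> real" where
  "mixture_density M \<theta> x =
     (\<Sum>l\<in>UNIV. fst \<theta> $ l * (\<Prod>p\<in>UNIV. local_density M p (x p) (snd \<theta> $ l)))"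

definition example_gradient ::
    "('k::finite, 'j::finite, 'p::finite, 'x, 'r) dpvi_spec \<Rightarrow> ('k, 'j) params \<Rightarrow>
     ('p \<Rightarrow> 'x) \<Rightarrow> real ^ ('k, 'j) entry" where
  "example_gradient M \<theta> x = (\<chi> e. case e of
      Inl k \<Rightarrow>
        (\<Prod>p\<in>UNIV. local_density M p (x p) (snd \<theta> $ k)) / mixture_density M \<theta> x
    | Inr (k, j) \<Rightarrow>
        fst \<theta> $ k *
        partial_deriv j (local_density M (owner M j) (x (owner M j))) (snd \<theta> $ k) *
        (\<Prod>p\<in>UNIV - {owner M j}. local_density M p (x p) (snd \<theta> $ k)) / mixture_density M \<theta> x)"

definition trunc :: "real \<Rightarrow> int" where
  "trunc a = (if a \<ge> 0 then \<lfloor>a\<rfloor> else \<lceil>a\<rceil>)"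

definition trunc_vec :: "real ^ 'd \<Rightarrow> int ^ 'd" where
  "trunc_vec v = (\<chi> i. trunc (v $ i))"

text \<open>The gradient enters as an integer vector; dividing it leaves the integers, so the quotient is
  again truncated towards zero, which does not increase the norm.\<close>

definition clip :: "real \<Rightarrow> int ^ 'd::finite \<Rightarrow> int ^ 'd" where
  "clip C g = trunc_vec (real_vec g /\<^sub>R max 1 (norm (real_vec g) / C))"

definition clipped_gradient ::
    "('k::finite, 'j::finite, 'p::finite, 'x, 'r) dpvi_spec \<Rightarrow> real \<Rightarrow> ('k, 'j) params \<Rightarrow>
     ('p \<Rightarrow> 'x) \<Rightarrow> int ^ ('k, 'j) entry" where
  "clipped_gradient M C \<theta> x = clip C (trunc_vec (fx_scale M *\<^sub>R example_gradient M \<theta> x))"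

text \<open>The joint law, for fixed data-independent randomness \<open>\<omega>\<close>, of the values released in the
  first \<open>t\<close> iterations and of the parameters before the first and after each of these iterations.
  In every iteration each party \<open>p\<close> contributes its own share \<open>\<zeta> p\<close> of the noise.\<close>

primrec dpvi_run ::
    "('k::finite, 'j::finite, 'p::finite, 'x, 'r) dpvi_spec \<Rightarrow> real \<Rightarrow> real \<Rightarrow> real \<Rightarrow> 'r \<Rightarrow>
     ('p \<Rightarrow> 'x) list \<Rightarrow> nat \<Rightarrow> ((int ^ ('k, 'j) entry) list \<times> ('k, 'j) params list) pmf" where
  "dpvi_run M q C \<sigma> \<omega> D 0 = return_pmf ([], [init_params M \<omega>])"
| "dpvi_run M q C \<sigma> \<omega> D (Suc t) =
     do {
       (gs, \<theta>s) \<leftarrow> dpvi_run M q C \<sigma> \<omega> D t;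
       B \<leftarrow> subsample q (length D);
       \<zeta> \<leftarrow> Pi_pmf (UNIV :: 'p set) 0
             (\<lambda>_. discrete_gaussian_vec (C\<^sup>2 * \<sigma>\<^sup>2 / real CARD('p)));
       let \<theta> = last \<theta>s;
           g = (\<Sum>n\<in>B. clipped_gradient M C \<theta> (D ! n)) + (\<Sum>p\<in>UNIV. \<zeta> p);
           \<theta>' = update_params M t \<omega> \<theta>
                  (real_vec g /\<^sub>R fx_scale M + log_prior_grad M t \<omega> \<theta> + entropy_grad M t \<omega> \<theta>)
       in return_pmf (gs @ [g], \<theta>s @ [\<theta>'])
     }"

text \<open>The outside analyst observes the released values and the parameters.\<close>

definition analyst_view ::
    "('k::finite, 'j::finite, 'p::finite, 'x, 'r) dpvi_spec \<Rightarrow> 'r measure \<Rightarrow>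
     real \<Rightarrow> nat \<Rightarrow> real \<Rightarrow> real \<Rightarrow> ('p \<Rightarrow> 'x) list \<Rightarrow>
     ((int ^ ('k, 'j) entry) list \<times> (nat \<Rightarrow> ('k, 'j) params)) measure" where
  "analyst_view M R q T C \<sigma> D = R \<bind> (\<lambda>\<omega>.
     distr (measure_pmf (dpvi_run M q C \<sigma> \<omega> D T))
       (count_space UNIV \<Otimes>\<^sub>M (\<Pi>\<^sub>M t\<in>{..T}. borel))
       (\<lambda>(gs, \<theta>s). (gs, \<lambda>t\<in>{..T}. \<theta>s ! t)))"

text \<open>Measurability of the ingredients, without which the law of the observations is undefined.\<close>

definition measurable_spec ::
    "('k::finite, 'j::finite, 'p::finite, 'x, 'r) dpvi_spec \<Rightarrow> 'r measure \<Rightarrow> bool" where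
  "measurable_spec M R \<longleftrightarrow>
     (\<forall>p x. party_density M p x \<in> borel_measurable borel) \<and>
     (\<forall>j x. partial_deriv j (local_density M (owner M j) x) \<in> borel_measurable borel) \<and>
     init_params M \<in> borel_measurable R \<and>
     (\<forall>t. (\<lambda>(\<omega>, \<theta>). log_prior_grad M t \<omega> \<theta>) \<in> borel_measurable (R \<Otimes>\<^sub>M borel)) \<and>
     (\<forall>t. (\<lambda>(\<omega>, \<theta>). entropy_grad M t \<omega> \<theta>) \<in> borel_measurable (R \<Otimes>\<^sub>M borel)) \<and>
     (\<forall>t. (\<lambda>(\<omega>, \<theta>, g). update_params M t \<omega> \<theta> g)
            \<in> borel_measurable (R \<Otimes>\<^sub>M borel \<Otimes>\<^sub>M borel))"

end

theory Submission
  imports Defs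
begin

text \<open>For a fixed value \<open>\<omega>\<close> of the data-independent randomness, the parameters are a function of the
  previously released values, so the run is a post-processing of a composition of the base mechanism
  with non-random adaptive choices, to which the oracle applies. The bound obtained for each \<open>\<omega>\<close>
  is then integrated over \<open>\<omega>\<close>. Applying the oracle to the composition with random \<open>\<omega>\<close> would not
  suffice, since the observed parameters are not a function of the released values alone.\<close>

section \<open>Noise shares and clipping\<close>

text \<open>The base mechanism numbers its noise shares by \<open>{..<P}\<close>, the algorithm by
  the type of parties. The shares are i.i.d., so any bijection between the two index sets carries
  one product law to the other and preserves the sum.\<close>

lemma distributed_discrete_gaussian_parties:
  "(distributed_discrete_gaussian CARD('p::finite) v :: (int ^ 'd::finite) pmf) =
     map_pmf (\<lambda>\<zeta>. \<Sum>p\<in>(UNIV :: 'p set). \<zeta> p)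
       (Pi_pmf UNIV 0 (\<lambda>_. discrete_gaussian_vec (v / real CARD('p))))"
proof -
  obtain h where h: "bij_betw h {..<CARD('p)} (UNIV :: 'p set)"
    using bij_betw_from_nat_into_finite[of "UNIV :: 'p set"] by auto
  let ?G = "discrete_gaussian_vec (v / real CARD('p)) :: (int ^ 'd) pmf"
  have inv: "bij_betw (inv_into {..<CARD('p)} h) (UNIV :: 'p set) {..<CARD('p)}"
    by (rule bij_betw_inv_into[OF h])
  have "Pi_pmf (UNIV :: 'p set) 0 (\<lambda>_. ?G) =
        map_pmf (\<lambda>g. g \<circ> inv_into {..<CARD('p)} h) (Pi_pmf {..<CARD('p)} 0 (\<lambda>_. ?G))"
    by (rule Pi_pmf_bij_betw[OF _ inv]) auto
  moreover have "(\<Sum>p\<in>(UNIV :: 'p set). g (inv_into {..<CARD('p)} h p)) = (\<Sum>i<CARD('p). g i)"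
    for g :: "nat \<Rightarrow> int ^ 'd"
    by (rule sum.reindex_bij_betw[OF inv])
  ultimately show ?thesis
    by (simp add: distributed_discrete_gaussian_def pmf.map_comp o_def)
qed

text \<open>Rounding towards zero shrinks every coordinate in absolute value; rounding down would
  not.\<close>

lemma norm_trunc_vec_le: "norm (real_vec (trunc_vec v)) \<le> norm v"
proof (rule norm_le_componentwise_cart)
  have "\<bar>real_of_int (trunc a)\<bar> \<le> \<bar>a\<bar>" for a
    unfolding trunc_def by (auto; linarith)
  then show "norm (real_vec (trunc_vec v) $ i) \<le> norm (v $ i)" for i
    by (simp add: real_vec_def trunc_vec_def)
qed

text \<open>The rescaled vector has norm min(|g|, C), and the final truncation can only decrease it.
  This makes the clipped gradients admissible for \<open>ddg_mechanism\<close>.\<close>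

lemma norm_clip_le:
  assumes "0 < C"
  shows "norm (real_vec (clip C g)) \<le> C"
proof -
  have "norm (real_vec (clip C g)) \<le> norm (real_vec g /\<^sub>R max 1 (norm (real_vec g) / C))"
    unfolding clip_def by (rule norm_trunc_vec_le)
  also have "\<dots> = norm (real_vec g) / max 1 (norm (real_vec g) / C)"
    by (simp add: divide_inverse mult.commute)
  also have "\<dots> \<le> C"
    using assms by (auto simp: field_simps max_def split: if_splits)
  finally show ?thesis .
qed

section \<open>The algorithm as a composition of the base mechanism\<close>

text \<open>Replays the updates from the released values alone; the stage-\<open>t\<close>
  parameters consult only the first \<open>t\<close> entries of \<open>os\<close>.\<close>

primrec params_after ::
    "('k::finite, 'j::finite, 'p::finite, 'x, 'r) dpvi_spec \<Rightarrow> 'r \<Rightarrow>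
     (int ^ ('k, 'j) entry) list \<Rightarrow> nat \<Rightarrow> ('k, 'j) params" where
  "params_after M \<omega> os 0 = init_params M \<omega>"
| "params_after M \<omega> os (Suc t) =
     (let \<theta> = params_after M \<omega> os t
      in update_params M t \<omega> \<theta>
           (real_vec (os ! t) /\<^sub>R fx_scale M + log_prior_grad M t \<omega> \<theta> + entropy_grad M t \<omega> \<theta>))"

lemma params_after_append:
  "t \<le> length os \<Longrightarrow> params_after M \<omega> (os @ [g]) t = params_after M \<omega> os t"
  by (induction t) (simp_all add: nth_append)

definition gradient_choice ::
    "('k::finite, 'j::finite, 'p::finite, 'x, 'r) dpvi_spec \<Rightarrow> real \<Rightarrow> 'r \<Rightarrow>
     (int ^ ('k, 'j) entry) list \<Rightarrow> nat \<Rightarrow> ('p \<Rightarrow> 'x) \<Rightarrow> int ^ ('k, 'j) entry" where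
  "gradient_choice M C \<omega> os i x = clipped_gradient M C (params_after M \<omega> os (length os)) x"

lemma length_compose_outputs:
  "os \<in> set_pmf (compose_outputs q A f D t) \<Longrightarrow> length os = t"
  by (induction t arbitrary: os) auto

text \<open>The run carries the parameters in its state, while the composition recomputes them from
  the outputs. Subsamples and noise have the same laws on both sides, so the two agree step by
  step.\<close>

lemma dpvi_run_eq_compose_outputs:
  fixes M :: "('k::finite, 'j::finite, 'p::finite, 'x, 'r) dpvi_spec"
  shows "dpvi_run M q C \<sigma> \<omega> D t =
    map_pmf (\<lambda>os. (os, map (params_after M \<omega> os) [0..<Suc t]))
      (compose_outputs q (ddg_mechanism C CARD('p) \<sigma>) (gradient_choice M C \<omega>) D t)"
proof (induction t)
  case (Suc t)
  show ?case
    unfolding dpvi_run.simps(2) Suc.IH compose_outputs.simps(2)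
    unfolding map_pmf_def bind_assoc_pmf bind_return_pmf
      run_mechanism_def ddg_mechanism_def base_mechanism.simps
      distributed_discrete_gaussian_parties
  proof (rule bind_pmf_cong[OF refl])
    fix os
    assume "os \<in> set_pmf (compose_outputs q
      \<lparr>example_values = {v. norm (real_vec v) \<le> C},
       noise = bind_pmf (Pi_pmf (UNIV :: 'p set) 0
          (\<lambda>_. discrete_gaussian_vec (C\<^sup>2 * \<sigma>\<^sup>2 / real CARD('p))))
          (\<lambda>x. return_pmf (\<Sum>p\<in>UNIV. x p))\<rparr>
      (gradient_choice M C \<omega>) D t)"
    \<comment> \<open>The congruence rule restricts \<open>os\<close> to the support, where its
      length is \<open>t\<close>. The parameter list has one entry more, so its last entry is at
      index \<open>t = length os\<close>, exactly where \<open>gradient_choice\<close> evaluates the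
      gradient.\<close>
    then have len: "length os = t"
      by (rule length_compose_outputs)
    have old: "map (params_after M \<omega> (os @ [g])) [0..<Suc t] = map (params_after M \<omega> os) [0..<Suc t]"
      for g
      using len by (auto intro: params_after_append)
    show "(case (os, map (params_after M \<omega> os) [0..<Suc t]) of (gs, \<theta>s) \<Rightarrow>
       bind_pmf (subsample q (length D)) (\<lambda>B.
        bind_pmf (Pi_pmf (UNIV :: 'p set) 0
          (\<lambda>_. discrete_gaussian_vec (C\<^sup>2 * \<sigma>\<^sup>2 / real CARD('p)))) (\<lambda>\<zeta>.
       let \<theta> = last \<theta>s;
           g = (\<Sum>n\<in>B. clipped_gradient M C \<theta> (D ! n)) + (\<Sum>p\<in>UNIV. \<zeta> p);
           \<theta>' = update_params M t \<omega> \<theta>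
                  (real_vec g /\<^sub>R fx_scale M + log_prior_grad M t \<omega> \<theta> + entropy_grad M t \<omega> \<theta>)
       in return_pmf (gs @ [g], \<theta>s @ [\<theta>'])))) =
      bind_pmf (subsample q (length D)) (\<lambda>B.
        bind_pmf (Pi_pmf (UNIV :: 'p set) 0
          (\<lambda>_. discrete_gaussian_vec (C\<^sup>2 * \<sigma>\<^sup>2 / real CARD('p)))) (\<lambda>\<zeta>.
        return_pmf (os @ [(\<Sum>i\<in>B. gradient_choice M C \<omega> os i (D ! i)) + (\<Sum>p\<in>UNIV. \<zeta> p)],
          map (params_after M \<omega> (os @ [(\<Sum>i\<in>B. gradient_choice M C \<omega> os i (D ! i)) + (\<Sum>p\<in>UNIV. \<zeta> p)]))
            [0..<Suc (Suc t)])))"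
      unfolding prod.case upt_Suc_append[OF le0, of "Suc t"] map_append old
      using len by (simp add: Let_def gradient_choice_def nth_append params_after_append)
  qed
qed (simp add: map_pmf_def bind_return_pmf)

section \<open>Measurability in the data-independent randomness\<close>

text \<open>Makes the composition a Markov kernel in \<omega>. Histories and subsamples can be
  indexed by countable types, so it suffices to treat each of their values separately.\<close>

lemma measurable_compose_outputs:
  fixes f :: "'r \<Rightarrow> (int ^ 'd::finite) list \<Rightarrow> nat \<Rightarrow> 's \<Rightarrow> int ^ 'd"
  assumes f [measurable]: "\<And>os i x. (\<lambda>\<omega>. f \<omega> os i x) \<in> measurable R (count_space UNIV)"
  shows "(\<lambda>\<omega>. measure_pmf (compose_outputs q A (f \<omega>) D t))
           \<in> measurable R (subprob_algebra (count_space UNIV))"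
proof (induction t)
  case (Suc t)
  have sum [measurable]: "(\<lambda>\<omega>. \<Sum>i\<in>B. f \<omega> os i (D ! i)) \<in> measurable R (count_space UNIV)"
    for B os
  proof (induction B rule: infinite_finite_induct)
    case (insert i B)
    note insert.IH [measurable]
    have "(\<lambda>\<omega>. f \<omega> os i (D ! i) + (\<Sum>i\<in>B. f \<omega> os i (D ! i))) \<in> measurable R (count_space UNIV)"
      by measurable
    then show ?case
      using insert.hyps by simp
  qed simp_all
  \<comment> \<open>The law of the extended history when the sum before noise is \<open>s\<close>.
    Randomness \<omega> enters only through \<open>s\<close>, a discrete value, and every function
    of a discrete value is measurable.\<close>
  define K where "K s os = bind_pmf (map_pmf (\<lambda>\<zeta>. s + \<zeta>) (noise A)) (\<lambda>out. return_pmf (os @ [out]))"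
    for s os
  have K: "(\<lambda>\<omega>. measure_pmf (K (\<Sum>i\<in>B. f \<omega> os i (D ! i)) os))
      \<in> measurable R (subprob_algebra (count_space UNIV))" for B os
    by (rule measurable_compose[OF sum]) (rule measurable_measure_pmf)
  have step: "(\<lambda>\<omega>. measure_pmf (bind_pmf (subsample q (length D)) (\<lambda>B.
        K (\<Sum>i\<in>B. f \<omega> os i (D ! i)) os))) \<in> measurable R (subprob_algebra (count_space UNIV))" for os
  proof -
    \<comment> \<open>The type of sets of naturals is uncountable, whereas that of lists is countable.\<close>
    have eq: "bind_pmf (subsample q (length D)) (\<lambda>B. K (\<Sum>i\<in>B. f \<omega> os i (D ! i)) os) =
      bind_pmf (map_pmf sorted_list_of_set (subsample q (length D)))
        (\<lambda>b. K (\<Sum>i\<in>set b. f \<omega> os i (D ! i)) os)" for \<omega>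
      unfolding bind_map_pmf
      \<comment> \<open>Subsamples are finite, so \<open>set\<close> inverts
        \<open>sorted_list_of_set\<close> on the support.\<close>
      by (intro bind_pmf_cong refl) (auto simp: subsample_def)
    show ?thesis
      unfolding eq measure_pmf_bind
      by (rule measurable_bind[where N = "count_space UNIV"])
        (auto intro!: measurable_compose_countable'[where I = UNIV and g = snd, OF _ measurable_snd]
          measurable_compose[OF measurable_fst K])
  qed
  have "(\<lambda>\<omega>. measure_pmf (compose_outputs q A (f \<omega>) D t) \<bind> (\<lambda>os. measure_pmf
     (bind_pmf (subsample q (length D)) (\<lambda>B. K (\<Sum>i\<in>B. f \<omega> os i (D ! i)) os))))
     \<in> measurable R (subprob_algebra (count_space UNIV))"
    by (rule measurable_bind[OF Suc.IH])
      (auto intro!: measurable_compose_countable'[where I = UNIV and g = snd, OF _ measurable_snd]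
        measurable_compose[OF measurable_fst step])
  then show ?case
    by (simp add: measure_pmf_bind run_mechanism_def K_def)
qed simp

text \<open>The target is countable, so preimages of singletons suffice; each is a finite
  intersection of coordinate conditions.\<close>

lemma measurable_trunc_vec:
  "trunc_vec \<in> measurable (borel :: (real ^ 'd::finite) measure) (count_space UNIV)"
proof (subst measurable_count_space_eq_countable, simp, safe)
  fix c :: "int ^ 'd"
  have [measurable]: "trunc \<in> measurable borel (count_space UNIV)"
    unfolding trunc_def by measurable
  have [measurable]: "(\<lambda>v :: real ^ 'd. v $ i) \<in> borel_measurable borel" for i
    by (intro borel_measurable_continuous_onI continuous_intros)
  have "trunc_vec -` {c} \<inter> space borel = {v \<in> space borel. \<forall>i. trunc (v $ i) = c $ i}"
    by (auto simp: trunc_vec_def vec_eq_iff)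
  also have "\<dots> \<in> sets borel"
    by measurable
  finally show "trunc_vec -` {c} \<inter> space borel \<in> sets borel" .
qed simp

lemma borel_measurable_vecI:
  fixes f :: "'a \<Rightarrow> real ^ 'n::finite"
  assumes "\<And>i. (\<lambda>x. f x $ i) \<in> borel_measurable N"
  shows "f \<in> borel_measurable N"
  using assms by (subst borel_measurable_euclidean_space) (auto simp: Basis_vec_def inner_axis)

lemma measurable_local_density:
  assumes "party_density M p x \<in> borel_measurable borel"
  shows "local_density M p x \<in> borel_measurable borel"
proof -
  have "block (owner M) p \<in> borel_measurable borel"
  proof (rule borel_measurable_vecI)
    show "(\<lambda>r. block (owner M) p r $ i) \<in> borel_measurable borel" for i
      unfolding block_def
      by (cases "owner M i = p")
        (auto intro!: borel_measurable_continuous_onI continuous_intros)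
  qed
  from measurable_compose[OF this assms] show ?thesis
    by (simp add: local_density_def[abs_def])
qed

lemma measurable_example_gradient:
  fixes M :: "('k::finite, 'j::finite, 'p::finite, 'x, 'r) dpvi_spec"
  assumes "measurable_spec M R"
  shows "(\<lambda>\<theta>. example_gradient M \<theta> x) \<in> borel_measurable borel"
proof (rule borel_measurable_vecI)
  fix e
  have comp: "(\<lambda>\<theta> :: ('k, 'j) params. snd \<theta> $ k) \<in> borel_measurable borel" for k
    by (intro borel_measurable_continuous_onI continuous_intros)
  have [measurable]: "(\<lambda>\<theta> :: ('k, 'j) params. fst \<theta> $ k) \<in> borel_measurable borel" for k
    by (intro borel_measurable_continuous_onI continuous_intros)
  have [measurable]: "(\<lambda>\<theta> :: ('k, 'j) params. local_density M p y (snd \<theta> $ k)) \<in> borel_measurable borel"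
    for p y k
    by (rule measurable_compose[OF comp measurable_local_density])
      (use assms in \<open>auto simp: measurable_spec_def\<close>)
  \<comment> \<open>Where no derivative exists, \<open>deriv\<close> is an arbitrary value, so this
    rests on \<open>measurable_spec\<close> and not on measurability of the density.\<close>
  have [measurable]: "(\<lambda>\<theta> :: ('k, 'j) params. partial_deriv j (local_density M (owner M j) y) (snd \<theta> $ k))
      \<in> borel_measurable borel" for j y k
    by (rule measurable_compose[OF comp])
      (use assms in \<open>auto simp: measurable_spec_def\<close>)
  have [measurable]: "(\<lambda>\<theta>. mixture_density M \<theta> x) \<in> borel_measurable borel"
    unfolding mixture_density_def by measurable
  \<comment> \<open>Since x / 0 = 0, quotients of Borel functions are Borel even where the mixture
    density vanishes.\<close>
  show "(\<lambda>\<theta>. example_gradient M \<theta> x $ e) \<in> borel_measurable borel"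
    unfolding example_gradient_def by (cases e) (auto split: prod.splits)
qed

lemma measurable_clipped_gradient:
  assumes "measurable_spec M R"
  shows "(\<lambda>\<theta>. clipped_gradient M C \<theta> x) \<in> measurable borel (count_space UNIV)"
proof -
  note measurable_example_gradient[OF assms, measurable] measurable_trunc_vec[measurable]
  show ?thesis
    unfolding clipped_gradient_def
    by (rule measurable_compose[where N = "count_space UNIV" and g = "clip C"]) measurable
qed

text \<open>Randomness \<omega> enters each update both directly and through the previous
  parameters, hence the use of joint measurability.\<close>

lemma measurable_params_after:
  fixes M :: "('k::finite, 'j::finite, 'p::finite, 'x, 'r) dpvi_spec"
  assumes "measurable_spec M R"
  shows "(\<lambda>\<omega>. params_after M \<omega> os t) \<in> borel_measurable R"
proof (induction t)
  case 0
  then show ?case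
    using assms by (simp add: measurable_spec_def)
next
  case (Suc t)
  note Suc.IH [measurable]
  have comp: "(\<lambda>\<omega>. h \<omega> (params_after M \<omega> os t)) \<in> borel_measurable R"
    if "(\<lambda>(\<omega>, \<theta>). h \<omega> \<theta>) \<in> borel_measurable (R \<Otimes>\<^sub>M borel)"
    for h :: "_ \<Rightarrow> _ \<Rightarrow> real ^ ('k, 'j) entry"
    using measurable_compose[OF _ that, of "\<lambda>\<omega>. (\<omega>, params_after M \<omega> os t)" R] by simp
  have [measurable]:
    "(\<lambda>\<omega>. log_prior_grad M t \<omega> (params_after M \<omega> os t)) \<in> borel_measurable R"
    "(\<lambda>\<omega>. entropy_grad M t \<omega> (params_after M \<omega> os t)) \<in> borel_measurable R"
    using assms comp[of "log_prior_grad M t"] comp[of "entropy_grad M t"]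
    by (auto simp: measurable_spec_def)
  have upd: "(\<lambda>(\<omega>, \<theta>, g). update_params M t \<omega> \<theta> g) \<in> borel_measurable (R \<Otimes>\<^sub>M borel \<Otimes>\<^sub>M borel)"
    using assms by (simp add: measurable_spec_def)
  have "(\<lambda>\<omega>. (\<omega>, params_after M \<omega> os t,
      real_vec (os ! t) /\<^sub>R fx_scale M + log_prior_grad M t \<omega> (params_after M \<omega> os t)
        + entropy_grad M t \<omega> (params_after M \<omega> os t)))
    \<in> measurable R (R \<Otimes>\<^sub>M borel \<Otimes>\<^sub>M borel)"
    by measurable
  from measurable_compose[OF this upd] show ?case
    by (simp add: Let_def)
qed

lemma measurable_gradient_choice:
  assumes "measurable_spec M R"
  shows "(\<lambda>\<omega>. gradient_choice M C \<omega> os i x) \<in> measurable R (count_space UNIV)"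
  unfolding gradient_choice_def
  by (rule measurable_compose[OF measurable_params_after measurable_clipped_gradient]) (rule assms)+

section \<open>Privacy\<close>

text \<open>Lets the oracle, whose guarantee is stated for random choices, be applied to a choice
  frozen at one value of \<omega>.\<close>

lemma composition_const:
  assumes "prob_space R"
  shows "composition q T A R (\<lambda>_. f) D = measure_pmf (compose_outputs q A f D T)"
  unfolding composition_def by (rule bind_const'[OF assms]) (rule measure_pmf.subprob_space_axioms)

theorem theorem5p2:
  fixes M :: "('k::finite, 'j::finite, 'p::finite, 'x, 'r) dpvi_spec"
    and R :: "'r measure"
    and \<O> :: "real \<Rightarrow> real \<Rightarrow> nat \<Rightarrow> ('k, 'j) entry base_mechanism \<Rightarrow> ereal"
    and \<delta> q C \<sigma> :: real and T :: nat
  assumes "accounting_oracle TYPE('p \<Rightarrow> 'x) TYPE('r) \<O>"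
    and "0 \<le> \<delta>" "0 \<le> q" "q \<le> 1" "0 < C" "0 < \<sigma>"
    and "prob_space R" "measurable_spec M R" "0 < fx_scale M"
  shows "ext_differentially_private (\<O> \<delta> q T (ddg_mechanism C CARD('p) \<sigma>)) \<delta>
           (analyst_view M R q T C \<sigma>)"
proof -
  interpret R: prob_space R by fact
  define A :: "('k, 'j) entry base_mechanism" where "A = ddg_mechanism C CARD('p) \<sigma>"
  define f where "f = gradient_choice M C"
  define N where "N = (count_space UNIV :: (int ^ ('k, 'j) entry) list measure)
    \<Otimes>\<^sub>M (\<Pi>\<^sub>M t\<in>{..T}. (borel :: ('k, 'j) params measure))"
  define view where "view \<omega> os = (os, \<lambda>t\<in>{..T}. params_after M \<omega> os t)" for \<omega> os
  \<comment> \<open>The conditional law of the observations given \<omega>: the image of the outputs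
    under a map that does not depend on the dataset.\<close>
  define \<K> where "\<K> D \<omega> = distr (measure_pmf (compose_outputs q A (f \<omega>) D T)) N (view \<omega>)" for D \<omega>

  have fixed: "ext_differentially_private (\<O> \<delta> q T A) \<delta>
      (\<lambda>D. measure_pmf (compose_outputs q A (f \<omega>) D T))" for \<omega>
  proof -
    have "adaptive_choice A R (\<lambda>_. f \<omega>)"
      by (simp add: norm_clip_le[OF \<open>0 < C\<close>] adaptive_choice_def A_def f_def
          ddg_mechanism_def gradient_choice_def clipped_gradient_def)
    with assms have "ext_differentially_private (\<O> \<delta> q T A) \<delta> (composition q T A R (\<lambda>_. f \<omega>))"
      unfolding accounting_oracle_def by blast
    then show ?thesis
      unfolding composition_const[OF \<open>prob_space R\<close>, abs_def] .
  qed

  have params [measurable]: "(\<lambda>\<omega>. params_after M \<omega> os t) \<in> borel_measurable R" for os t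
    by (rule measurable_params_after) fact
  have "(\<lambda>\<omega>. view \<omega> os) \<in> measurable R N" for os
    unfolding view_def N_def by measurable
  \<comment> \<open>There are countably many output lists, so measurability in \<omega> for each
    fixed list gives joint measurability.\<close>
  then have view: "case_prod view \<in> measurable (R \<Otimes>\<^sub>M count_space UNIV) N"
    using measurable_compose_countable'[where I = UNIV and g = snd, OF _ measurable_snd,
        of "\<lambda>os x. view (fst x) os" R N]
    by (auto simp: case_prod_beta' intro: measurable_compose[OF measurable_fst])
  have kernel: "\<K> D \<in> measurable R (subprob_algebra N)" for D
    unfolding \<K>_def f_def
    by (intro measurable_distr2[OF view] measurable_compose_outputs measurable_gradient_choice) fact

  have analyst: "analyst_view M R q T C \<sigma> D = R \<bind> \<K> D" for D
  proof -
    have "(\<lambda>t\<in>{..T}. map (params_after M \<omega> os) [0..<Suc T] ! t) = (\<lambda>t\<in>{..T}. params_after M \<omega> os t)"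
      for \<omega> os
      by (auto simp del: upt_Suc)
    then show ?thesis
      unfolding analyst_view_def \<K>_def dpvi_run_eq_compose_outputs map_pmf_rep_eq N_def A_def f_def
      by (subst distr_distr) (auto simp: o_def view_def[abs_def] space_pair_measure space_PiM
          split: if_splits)
  qed
  have prob: "measure (analyst_view M R q T C \<sigma> D) S = (\<integral>\<omega>. measure (\<K> D \<omega>) S \<partial>R)"
    if "S \<in> sets N" for D S
    unfolding analyst by (rule R.measure_bind[OF kernel that])

  show ?thesis
  proof (cases "\<O> \<delta> q T A")
    case (real \<epsilon>)
    have "measure (analyst_view M R q T C \<sigma> D) S
        \<le> exp \<epsilon> * measure (analyst_view M R q T C \<sigma> D') S + \<delta>"
      if adj: "adjacent D D'" and S: "S \<in> sets (analyst_view M R q T C \<sigma> D)" for D D' S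
    proof -
      have S [measurable]: "S \<in> sets N"
        using S sets_bind[of R "\<K> D" N] sets_kernel[OF kernel] R.not_empty by (simp add: analyst)
      have \<K>: "measure (\<K> D \<omega>) S =
          measure (measure_pmf (compose_outputs q A (f \<omega>) D T)) (view \<omega> -` S)"
        if "\<omega> \<in> space R" for D \<omega>
        using measurable_Pair2[OF view that] S unfolding \<K>_def by (subst measure_distr) auto
      have le: "measure (\<K> D \<omega>) S \<le> exp \<epsilon> * measure (\<K> D' \<omega>) S + \<delta>" if "\<omega> \<in> space R" for \<omega>
        using fixed[of \<omega>] adj
        by (auto simp: \<K>[OF that] real differentially_private_def)
      have int: "integrable R (\<lambda>\<omega>. measure (\<K> D \<omega>) S)" for D
      proof (rule R.integrable_const_bound[where B = 1])
        show "AE \<omega> in R. norm (measure (\<K> D \<omega>) S) \<le> 1"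
          by (rule AE_I2) (simp add: \<K> measure_pmf.prob_le_1)
        show "(\<lambda>\<omega>. measure (\<K> D \<omega>) S) \<in> borel_measurable R"
          using measurable_compose[OF kernel measurable_measure_subprob_algebra[OF S]] .
      qed
      have "(\<integral>\<omega>. measure (\<K> D \<omega>) S \<partial>R) \<le> (\<integral>\<omega>. exp \<epsilon> * measure (\<K> D' \<omega>) S + \<delta> \<partial>R)"
        by (intro integral_mono Bochner_Integration.integrable_add integrable_mult_right int)
          (auto intro: le)
      \<comment> \<open>\<open>R\<close> has total mass 1, so averaging leaves \<delta>
        unchanged.\<close>
      also have "\<dots> = exp \<epsilon> * (\<integral>\<omega>. measure (\<K> D' \<omega>) S \<partial>R) + \<delta>"
        by (simp add: int R.prob_space)
      finally show ?thesis
        by (simp add: prob S)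
    qed
    then show ?thesis
      using real by (simp add: A_def differentially_private_def)
  next
    case PInf
    then show ?thesis
      using ext_differentially_private.simps(2)[of \<delta> "analyst_view M R q T C \<sigma>"]
      by (simp add: A_def)
  next
    case MInf
    then show ?thesis
      \<comment> \<open>With the answer -\<infinity>, \<open>fixed\<close> itself would be
        \<open>False\<close>.\<close>
      using fixed ext_differentially_private.simps(3)[of \<delta>] by fastforce
  qed
qed

end
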